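(* Let $\Omega\subset\mathbb C$ be a domain and let $\mathcal H$ be a holomorphic function in $\Omega$. Then for all test functions $\eta\in\mathscr C_0^\infty(\Omega)$, $\eta\not\equiv0$, $$\int_\Omega|\mathcal H(\xi)|\,|\eta_{\bar\xi}|^2\,\mathbf{d}\xi\;\geqslant\;\left|\int_\Omega\mathcal H(\xi)\,\eta_\xi\,\eta_{\bar\xi}\,\mathbf{d}\xi\right| .$$
   Context: $\xi$ is the complex variable in $\Omega$, $\mathbf{d}\xi$ the area element, $\eta_\xi=\frac12(\partial_x-i\partial_y)\eta$ and $\eta_{\bar\xi}=\frac12(\partial_x+i\partial_y)\eta$. Functions in $\mathscr C_0^\infty(\Omega)$ are complex valued, smooth, with compact support in $\Omega$. *)

theory Defs
  imports "HOL-Analysis.Analysis"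
begin

text \<open>
  Differentiability is meant in the real sense throughout: the predicate
  \<^term>\<open>f differentiable (at z)\<close> asks for a real-linear derivative, and \<open>\<complex>\<close> is
  the real plane with basis \<open>1, \<i>\<close>.  For an open set \<open>S\<close> the following depends only
  on the values of \<open>f\<close> on \<open>S\<close>.
\<close>

primrec Ck_on :: "nat \<Rightarrow> complex set \<Rightarrow> (complex \<Rightarrow> complex) \<Rightarrow> bool" where
  "Ck_on 0 S f \<longleftrightarrow> continuous_on S f"
| "Ck_on (Suc k) S f \<longleftrightarrow>
     (\<forall>z\<in>S. f differentiable (at z)) \<and>
     (\<forall>v. Ck_on k S (\<lambda>z. frechet_derivative f (at z) v))"

definition smooth_on :: "complex set \<Rightarrow> (complex \<Rightarrow> complex) \<Rightarrow> bool" where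
  "smooth_on S f \<longleftrightarrow> (\<forall>k. Ck_on k S f)"

text \<open>
  Functions on \<open>\<Omega>\<close> are represented by total functions whose values outside \<open>\<Omega>\<close> are
  irrelevant.
\<close>

definition test_functions :: "complex set \<Rightarrow> (complex \<Rightarrow> complex) set" where
  "test_functions \<Omega> =
     {\<eta>. smooth_on \<Omega> \<eta> \<and>
         compact (closure (support_on \<Omega> \<eta>)) \<and> closure (support_on \<Omega> \<eta>) \<subseteq> \<Omega>}"

definition partial_x :: "(complex \<Rightarrow> complex) \<Rightarrow> complex \<Rightarrow> complex" where
  "partial_x f z = frechet_derivative f (at z) 1"

definition partial_y :: "(complex \<Rightarrow> complex) \<Rightarrow> complex \<Rightarrow> complex" where
  "partial_y f z = frechet_derivative f (at z) \<i>"

definition wirtinger :: "(complex \<Rightarrow> complex) \<Rightarrow> complex \<Rightarrow> complex" where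
  "wirtinger f z = (partial_x f z - \<i> * partial_y f z) / 2"

definition wirtinger_bar :: "(complex \<Rightarrow> complex) \<Rightarrow> complex \<Rightarrow> complex" where
  "wirtinger_bar f z = (partial_x f z + \<i> * partial_y f z) / 2"

end

theory Submission
  imports Defs "HOL-Complex_Analysis.Conformal_Mappings"
begin

text \<open>
  If \<open>H\<close> had a holomorphic square root \<open>h\<close>, then \<open>F = h \<eta>\<close> would be a test function, the two
  integrals would be those of \<open>|F_zbar|^2\<close> and \<open>F_z F_zbar\<close> (they differ from the originals by the
  integral of \<open>H' (\<eta>^2)_zbar / 4\<close>, which is \<open>0\<close>), and \<open>F_z\<close> and \<open>F_zbar\<close> have the same L2 norm.
  Zeros of odd order and holes of \<open>\<Omega>\<close> obstruct the root, but only
  \<open>|F_zbar|^2 = |H| |\<eta>_zbar|^2\<close> and \<open>|F_z|^2 = |H| |\<eta>_z + (log |H|)_z \<eta>|^2\<close> matter.  Replace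
  \<open>|H|\<close> by the smooth weight \<open>w = sqrt (|H|^2 + e)\<close>.  For \<open>D = \<partial>_z + (log w)_z\<close> the commutator of
  \<open>\<partial>_zbar\<close> and \<open>D\<close> is multiplication by \<open>(log w)_zzbar \<ge> 0\<close>, so \<open>D \<eta>\<close> is bounded by
  \<open>\<eta>_zbar\<close> in the L2 norm with weight \<open>w\<close>.  Let \<open>e\<close> tend to \<open>0\<close>.
\<close>

section \<open>Integrals of compactly supported functions and of their derivatives\<close>

text \<open>Multiplying \<open>g\<close> by the indicator of \<open>S\<close> or by that of
  \<open>K\<close> gives the same function, and a continuous function is integrable over a compact
  set. This settles integrability for all the set integrals below.\<close>

lemma integrable_continuous_compact_support:
  fixes g :: "'a::euclidean_space \<Rightarrow> 'b::{banach, second_countable_topology}"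
  assumes "continuous_on S g" "compact K" "K \<subseteq> S" "\<And>x. x \<in> S - K \<Longrightarrow> g x = 0"
  shows "set_integrable lborel S g"
proof -
  have "(\<lambda>x. indicator S x *\<^sub>R g x) = (\<lambda>x. indicator K x *\<^sub>R g x)"
    using assms(3,4) by (fastforce simp: indicator_def)
  then show ?thesis
    using borel_integrable_compact[OF assms(2) continuous_on_subset[OF assms(1,3)]]
    by (simp add: set_integrable_def)
qed

text \<open>
  The integrals of the difference quotients vanish by translation invariance, and dominated
  convergence passes to the limit.
\<close>

lemma integral_derivative_compact_support:
  fixes g :: "'a::euclidean_space \<Rightarrow> 'b::euclidean_space"
  assumes der: "\<And>x. (g has_derivative g' x) (at x)"
    and bd: "\<And>x. onorm (g' x) \<le> B"
    and K: "compact K" and zero: "\<And>x. x \<notin> K \<Longrightarrow> g x = 0"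
  shows "(LINT x|lborel. g' x v) = 0"
proof -
  \<comment> \<open>The difference quotient of \<open>g\<close> for the increment
    \<open>v / (n + 1)\<close>; \<open>Suc n\<close> keeps the denominator positive and the
    increment no longer than \<open>v\<close>.\<close>
  define d where "d n x = real (Suc n) *\<^sub>R (g (x + v /\<^sub>R real (Suc n)) - g x)" for n x
  have cont: "continuous_on UNIV g"
    using der by (meson continuous_at_imp_continuous_on has_derivative_continuous)
  have meas: "g \<in> borel_measurable borel"
    using cont by (rule borel_measurable_continuous_onI)
  have int_g: "integrable lborel g"
    using integrable_continuous_compact_support[OF cont K] zero by (simp add: set_integrable_def)
  have shift: "integrable lborel (\<lambda>x. g (x + c))" "(LINT x|lborel. g (x + c)) = (LINT x|lborel. g x)" for c
  proof -
    have "integrable (distr lborel borel ((+) c)) g"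
      using int_g by (simp add: lborel_distr_plus)
    then show "integrable lborel (\<lambda>x. g (x + c))"
      by (subst (asm) integrable_distr_eq) (use meas in \<open>auto simp: add.commute\<close>)
    have "(LINT x|lborel. g x) = (LINT x|distr lborel borel ((+) c). g x)"
      by (simp add: lborel_distr_plus)
    also have "\<dots> = (LINT x|lborel. g (x + c))"
      by (subst integral_distr) (use meas in \<open>auto simp: add.commute\<close>)
    finally show "(LINT x|lborel. g (x + c)) = (LINT x|lborel. g x)" by simp
  qed
  have int_d: "(LINT x|lborel. d n x) = 0" for n
    unfolding d_def using shift int_g by simp
  have d_meas: "d n \<in> borel_measurable lborel" for n
    unfolding d_def using meas by measurable
  obtain R where R: "\<And>x. x \<in> K \<Longrightarrow> norm x \<le> R"
    using compact_imp_bounded[OF K] bounded_iff by blast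
  have lip: "norm (g x - g y) \<le> B * norm (x - y)" for x y
    by (rule differentiable_bound[of UNIV g g' B]) (use der bd in auto)
  \<comment> \<open>The Lipschitz constant \<open>B\<close> bounds the quotients uniformly in
    \<open>n\<close>. Since increments have norm at most \<open>norm v\<close>, all quotients vanish
    outside the ball that enlarges the one around \<open>K\<close> by \<open>norm v\<close>.\<close>
  have dom: "norm (d n x) \<le> indicator (cball 0 (R + norm v)) x * (B * norm v)" for n x
  proof (cases "x \<in> cball 0 (R + norm v)")
    case True
    have "norm (d n x) = real (Suc n) * norm (g (x + v /\<^sub>R real (Suc n)) - g x)"
      by (simp add: d_def)
    also have "\<dots> \<le> real (Suc n) * (B * norm (x + v /\<^sub>R real (Suc n) - x))"
      by (intro mult_left_mono lip) auto
    also have "\<dots> = B * norm v" by (simp add: field_simps)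
    finally show ?thesis using True by simp
  next
    case False
    have "norm (v /\<^sub>R real (Suc n)) \<le> norm v"
      by (simp add: field_simps mult_le_cancel_left1)
    then have "norm x \<le> norm (x + v /\<^sub>R real (Suc n)) + norm v"
      using norm_diff_ineq[of x "v /\<^sub>R real (Suc n)"] by linarith
    then have "x \<notin> K" "x + v /\<^sub>R real (Suc n) \<notin> K"
      using False R[of x] R[of "x + v /\<^sub>R real (Suc n)"] norm_ge_zero[of v] by auto
    then have "d n x = 0" by (simp add: d_def zero)
    then show ?thesis using False by simp
  qed
  \<comment> \<open>The derivative of \<open>h \<mapsto> g (x + h v)\<close> at
    \<open>h = 0\<close>, sampled along \<open>h = 1 / (n + 1)\<close>.\<close>
  have lim: "(\<lambda>n. d n x) \<longlonglongrightarrow> g' x v" for x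
  proof -
    have "((\<lambda>h. g (x + h *\<^sub>R v)) has_derivative (\<lambda>h. g' x (h *\<^sub>R v))) (at 0)"
      by (rule has_derivative_compose[of "\<lambda>h. x + h *\<^sub>R v" "\<lambda>h. h *\<^sub>R v" 0 UNIV g "g' x"])
         (use der in \<open>auto intro!: derivative_eq_intros\<close>)
    then have "((\<lambda>h. g (x + h *\<^sub>R v)) has_vector_derivative g' x v) (at 0)"
      using linear_scale[OF has_derivative_linear[OF der[of x]]]
      by (simp add: has_vector_derivative_def)
    then have "((\<lambda>h. (g (x + h *\<^sub>R v) - g (x + 0 *\<^sub>R v) - (h - 0) *\<^sub>R g' x v) /\<^sub>R norm (h - 0)) \<longlongrightarrow> 0) (at 0)"
      unfolding has_vector_derivative_def has_derivative_at_within by (rule conjunct2)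
    from tendsto_norm_zero[OF this]
    have "((\<lambda>h. norm ((g (x + h *\<^sub>R v) - g x - h *\<^sub>R g' x v) /\<^sub>R norm h)) \<longlongrightarrow> 0) (at 0)"
      by (simp only: diff_0_right scaleR_zero_left add_0_right)
    moreover have "\<forall>\<^sub>F h in at 0. norm ((g (x + h *\<^sub>R v) - g x - h *\<^sub>R g' x v) /\<^sub>R norm h)
        = norm ((1/h) *\<^sub>R (g (x + h *\<^sub>R v) - g x) - g' x v)"
      unfolding eventually_at_filter
    proof (intro always_eventually allI impI)
      fix h :: real assume "h \<noteq> 0"
      then have "(1/h) *\<^sub>R (g (x + h *\<^sub>R v) - g x) - g' x v = (1/h) *\<^sub>R (g (x + h *\<^sub>R v) - g x - h *\<^sub>R g' x v)"
        by (simp add: algebra_simps)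
      then show "norm ((g (x + h *\<^sub>R v) - g x - h *\<^sub>R g' x v) /\<^sub>R norm h)
        = norm ((1/h) *\<^sub>R (g (x + h *\<^sub>R v) - g x) - g' x v)"
        by (simp add: divide_inverse)
    qed
    ultimately have "((\<lambda>h. norm ((1/h) *\<^sub>R (g (x + h *\<^sub>R v) - g x) - g' x v)) \<longlongrightarrow> 0) (at 0)"
      by (rule Lim_transform_eventually)
    then have "((\<lambda>h. (1/h) *\<^sub>R (g (x + h *\<^sub>R v) - g x)) \<longlongrightarrow> g' x v) (at 0)"
      by (rule LIM_zero_cancel[OF tendsto_norm_zero_cancel])
    moreover have "filterlim (\<lambda>n. 1 / real (Suc n)) (at 0) sequentially"
      using LIMSEQ_inverse_real_of_nat[unfolded inverse_eq_divide]
      by (simp add: filterlim_at del: of_nat_Suc)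
    ultimately have "(\<lambda>n. (1/(1 / real (Suc n))) *\<^sub>R (g (x + (1 / real (Suc n)) *\<^sub>R v) - g x)) \<longlonglongrightarrow> g' x v"
      by (rule filterlim_compose)
    then show ?thesis by (simp add: d_def[abs_def] inverse_eq_divide)
  qed
  have "(\<lambda>n. LINT x|lborel. d n x) \<longlonglongrightarrow> (LINT x|lborel. g' x v)"
  proof (rule integral_dominated_convergence)
    show "integrable lborel (\<lambda>x. indicator (cball 0 (R + norm v)) x * (B * norm v))"
      by (intro integrable_mult_left) 
         (use emeasure_lborel_cball_finite in \<open>auto intro!: integrable_real_indicator\<close>)
    \<comment> \<open>Measurability is inherited from the quotients, whose pointwise limit this
      is.\<close>
    show "(\<lambda>x. g' x v) \<in> borel_measurable lborel"
      by (rule borel_measurable_LIMSEQ_metric[OF d_meas lim])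
  qed (use d_meas dom lim in auto)
  then show ?thesis by (simp add: int_d LIMSEQ_const_iff)
qed

section \<open>Symmetry of mixed second derivatives\<close>

text \<open>The mean value inequality is applied twice: along \<open>v\<close> to
  \<open>F x u\<close>, and then along \<open>u\<close> to the first difference of \<open>f\<close>
  in direction \<open>v\<close>. The constant \<open>C\<close> is a candidate for the mixed second
  derivative, and \<open>e\<close> is its error on the ball.\<close>

lemma mixed_difference_bound:
  fixes f :: "'a::real_normed_vector \<Rightarrow> 'b::real_normed_vector"
  assumes f: "\<And>x. x \<in> ball z r \<Longrightarrow> (f has_derivative F x) (at x)"
    and fu: "\<And>x. x \<in> ball z r \<Longrightarrow> ((\<lambda>x. F x u) has_derivative G x) (at x)"
    and near: "\<And>x. x \<in> ball z r \<Longrightarrow> norm (G x v - C) \<le> e"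
    and t: "0 < t" "t * (norm u + norm v) < r"
  shows "norm (f (z + t *\<^sub>R u + t *\<^sub>R v) - f (z + t *\<^sub>R u) - f (z + t *\<^sub>R v) + f z - t\<^sup>2 *\<^sub>R C) \<le> e * t\<^sup>2"
proof -
  have in_ball: "z + s *\<^sub>R u + s' *\<^sub>R v \<in> ball z r" if "s \<in> {0..t}" "s' \<in> {0..t}" for s s'
  proof -
    have "norm (s *\<^sub>R u + s' *\<^sub>R v) \<le> s * norm u + s' * norm v"
      using that norm_triangle_ineq[of "s *\<^sub>R u" "s' *\<^sub>R v"] by simp
    also have "\<dots> \<le> t * norm u + t * norm v"
      using that by (intro add_mono mult_right_mono) auto
    also have "\<dots> < r" using t by (simp add: algebra_simps)
    finally show ?thesis by (simp add: dist_norm add.assoc norm_minus_cancel[of "s *\<^sub>R u + s' *\<^sub>R v", symmetric] del: norm_minus_cancel)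
  qed
  have inner: "norm (F (z + s *\<^sub>R u + t *\<^sub>R v) u - F (z + s *\<^sub>R u) u - t *\<^sub>R C) \<le> e * t"
    if s: "s \<in> {0..t}" for s
  proof -
    \<comment> \<open>Subtracting the linear term leaves the derivative \<open>G x v - C\<close>,
      which is small by \<open>near\<close>.\<close>
    define h where "h s' = F (z + s *\<^sub>R u + s' *\<^sub>R v) u - s' *\<^sub>R C" for s'
    have "norm (h t - h 0) \<le> e * norm (t - 0)"
    proof (rule differentiable_bound[of "{0..t}" h "\<lambda>s' y. y *\<^sub>R (G (z + s *\<^sub>R u + s' *\<^sub>R v) v - C)"])
      fix s' assume s': "s' \<in> {0..t}"
      have "((\<lambda>s'. F (z + s *\<^sub>R u + s' *\<^sub>R v) u) has_derivative (\<lambda>y. G (z + s *\<^sub>R u + s' *\<^sub>R v) (y *\<^sub>R v))) (at s' within {0..t})"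
        by (rule has_derivative_compose[of "\<lambda>s'. z + s *\<^sub>R u + s' *\<^sub>R v" "\<lambda>y. y *\<^sub>R v" s' _ "\<lambda>x. F x u"])
          (use fu[OF in_ball[OF s s']] in \<open>auto intro!: derivative_eq_intros\<close>)
      then have "(h has_derivative (\<lambda>y. G (z + s *\<^sub>R u + s' *\<^sub>R v) (y *\<^sub>R v) - y *\<^sub>R C)) (at s' within {0..t})"
        unfolding h_def by (auto intro!: derivative_eq_intros)
      then show "(h has_derivative (\<lambda>y. y *\<^sub>R (G (z + s *\<^sub>R u + s' *\<^sub>R v) v - C))) (at s' within {0..t})"
        using linear_scale[OF has_derivative_linear[OF fu[OF in_ball[OF s s']]]]
        by (simp add: scaleR_diff_right)
      show "onorm (\<lambda>y. y *\<^sub>R (G (z + s *\<^sub>R u + s' *\<^sub>R v) v - C)) \<le> e"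
        using near[OF in_ball[OF s s']] 
        by (intro onorm_le) (metis mult.commute mult_right_mono norm_ge_zero norm_scaleR real_norm_def)
    qed (use t in auto)
    then show ?thesis using t by (simp add: h_def algebra_simps)
  qed
  \<comment> \<open>The correction \<open>(s * t) C\<close> is chosen so that
    \<open>k t - k 0\<close> is the mixed difference minus \<open>t^2 C\<close>, while the
    derivative of \<open>k\<close> is the quantity bounded in \<open>inner\<close>.\<close>
  define k where "k s = f (z + s *\<^sub>R u + t *\<^sub>R v) - f (z + s *\<^sub>R u) - (s * t) *\<^sub>R C" for s
  have "norm (k t - k 0) \<le> (e * t) * norm (t - 0)"
  proof (rule differentiable_bound[of "{0..t}" k "\<lambda>s y. y *\<^sub>R (F (z + s *\<^sub>R u + t *\<^sub>R v) u - F (z + s *\<^sub>R u) u - t *\<^sub>R C)"])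
    fix s assume s: "s \<in> {0..t}"
    have b1: "z + s *\<^sub>R u + t *\<^sub>R v \<in> ball z r" and b2: "z + s *\<^sub>R u \<in> ball z r"
      using in_ball[OF s, of t] in_ball[OF s, of 0] t by auto
    have "((\<lambda>s. f (z + s *\<^sub>R u + t *\<^sub>R v)) has_derivative (\<lambda>y. F (z + s *\<^sub>R u + t *\<^sub>R v) (y *\<^sub>R u))) (at s within {0..t})"
      by (rule has_derivative_compose[of "\<lambda>s. z + s *\<^sub>R u + t *\<^sub>R v" "\<lambda>y. y *\<^sub>R u" s _ f])
         (use f[OF b1] in \<open>auto intro!: derivative_eq_intros\<close>)
    moreover have "((\<lambda>s. f (z + s *\<^sub>R u)) has_derivative (\<lambda>y. F (z + s *\<^sub>R u) (y *\<^sub>R u))) (at s within {0..t})"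
      by (rule has_derivative_compose[of "\<lambda>s. z + s *\<^sub>R u" "\<lambda>y. y *\<^sub>R u" s _ f])
         (use f[OF b2] in \<open>auto intro!: derivative_eq_intros\<close>)
    ultimately have "(k has_derivative (\<lambda>y. F (z + s *\<^sub>R u + t *\<^sub>R v) (y *\<^sub>R u) - F (z + s *\<^sub>R u) (y *\<^sub>R u) - (y * t) *\<^sub>R C)) (at s within {0..t})"
      unfolding k_def by (auto intro!: derivative_eq_intros)
    then show "(k has_derivative (\<lambda>y. y *\<^sub>R (F (z + s *\<^sub>R u + t *\<^sub>R v) u - F (z + s *\<^sub>R u) u - t *\<^sub>R C))) (at s within {0..t})"
      using linear_scale[OF has_derivative_linear[OF f[OF b1]]] linear_scale[OF has_derivative_linear[OF f[OF b2]]]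
      by (simp add: scaleR_diff_right)
    show "onorm (\<lambda>y. y *\<^sub>R (F (z + s *\<^sub>R u + t *\<^sub>R v) u - F (z + s *\<^sub>R u) u - t *\<^sub>R C)) \<le> e * t"
      using inner[OF s] 
        by (intro onorm_le) (metis mult.commute mult_right_mono norm_ge_zero norm_scaleR real_norm_def)
  qed (use t in auto)
  then show ?thesis using t by (simp add: k_def algebra_simps power2_eq_square)
qed

text \<open>The mixed difference is symmetric in \<open>u\<close> and \<open>v\<close>. Divided by
  \<open>t^2\<close> it is within \<open>e / 2\<close> of both second derivatives, so these differ
  by at most \<open>e\<close>. Differentiability is asked of \<open>F\<close> in the two fixed
  directions only, which is what the Wirtinger derivatives supply for \<open>1\<close> and
  \<open>\<i>\<close>.\<close>

lemma second_derivative_symmetric: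
  fixes f :: "'a::real_normed_vector \<Rightarrow> 'b::real_normed_vector"
  assumes S: "open S" "z \<in> S"
    and f: "\<And>x. x \<in> S \<Longrightarrow> (f has_derivative F x) (at x)"
    and fu: "\<And>x. x \<in> S \<Longrightarrow> ((\<lambda>x. F x u) has_derivative G x) (at x)"
    and fv: "\<And>x. x \<in> S \<Longrightarrow> ((\<lambda>x. F x v) has_derivative G' x) (at x)"
    and cont: "continuous_on S (\<lambda>x. G x v)" "continuous_on S (\<lambda>x. G' x u)"
  shows "G z v = G' z u"
proof -
  have "norm (G z v - G' z u) \<le> e" if e: "0 < e" for e
  proof -
    have near: "\<forall>\<^sub>F x in at z. norm (g x - g z) < e / 2" if "continuous_on S g" for g :: "'a \<Rightarrow> 'b"
      using that S e tendstoD[of g "g z" "at z" "e / 2"]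
      by (simp add: continuous_on_eq_continuous_at isCont_def dist_norm)
    have "\<forall>\<^sub>F x in at z. x \<in> S \<and> norm (G x v - G z v) < e / 2 \<and> norm (G' x u - G' z u) < e / 2"
      using near[OF cont(1)] near[OF cont(2)] eventually_at_in_open'[OF S]
      by eventually_elim auto
    then obtain r where r: "r > 0" "\<And>x. x \<noteq> z \<Longrightarrow> dist x z < r \<Longrightarrow>
        x \<in> S \<and> norm (G x v - G z v) < e / 2 \<and> norm (G' x u - G' z u) < e / 2"
      unfolding eventually_at by auto
    \<comment> \<open>The punctured neighbourhood leaves out the centre \<open>z\<close>, where the
      bounds hold because \<open>e > 0\<close>.\<close>
    have r': "x \<in> S" "norm (G x v - G z v) \<le> e / 2" "norm (G' x u - G' z u) \<le> e / 2" if "x \<in> ball z r" for x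
      using that r(2)[of x] S e by (cases "x = z"; force simp: dist_commute)+
    \<comment> \<open>The summand \<open>1\<close> makes the denominator positive and
      \<open>t * (norm u + norm v)\<close> strictly smaller than \<open>r\<close>.\<close>
    define t where "t = r / (norm u + norm v + 1)"
    define \<Delta> where "\<Delta> = f (z + t *\<^sub>R u + t *\<^sub>R v) - f (z + t *\<^sub>R u) - f (z + t *\<^sub>R v) + f z"
    have t: "0 < t" "t * (norm u + norm v) < r"
      using r(1) by (auto simp: t_def field_simps add_pos_nonneg add_nonneg_pos)
    have "norm (\<Delta> - t\<^sup>2 *\<^sub>R G z v) \<le> e / 2 * t\<^sup>2"
      unfolding \<Delta>_def by (rule mixed_difference_bound[of z r f F u G v]) (use f fu r' t in auto)
    moreover have "\<Delta> = f (z + t *\<^sub>R v + t *\<^sub>R u) - f (z + t *\<^sub>R v) - f (z + t *\<^sub>R u) + f z"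
      by (simp add: \<Delta>_def algebra_simps)
    then have "norm (\<Delta> - t\<^sup>2 *\<^sub>R G' z u) \<le> e / 2 * t\<^sup>2"
      using mixed_difference_bound[of z r f F v G' u "G' z u" "e/2" t] f fv r' t
      by (simp add: add.commute[of "norm v"])
    ultimately have "norm (t\<^sup>2 *\<^sub>R (G z v - G' z u)) \<le> e * t\<^sup>2"
      using norm_triangle_ineq4[of "\<Delta> - t\<^sup>2 *\<^sub>R G' z u" "\<Delta> - t\<^sup>2 *\<^sub>R G z v"]
      by (simp add: scaleR_diff_right)
    then show ?thesis using t(1) by (simp add: mult.commute)
  qed
  then show ?thesis
    by (metis field_le_epsilon add_0 norm_le_zero_iff right_minus_eq)
qed

section \<open>Calculus of Wirtinger derivatives\<close>

text \<open>The functions \<open>p\<close> and \<open>q\<close> are the derivatives of \<open>f\<close> by \<open>z\<close> and by \<open>cnj z\<close>.\<close>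

definition has_wirtinger_on ::
  "(complex \<Rightarrow> complex) \<Rightarrow> (complex \<Rightarrow> complex) \<Rightarrow> (complex \<Rightarrow> complex) \<Rightarrow> complex set \<Rightarrow> bool" where
  "has_wirtinger_on f p q S \<longleftrightarrow> continuous_on S p \<and> continuous_on S q \<and>
     (\<forall>z\<in>S. (f has_derivative (\<lambda>v. p z * v + q z * cnj v)) (at z))"

lemma has_wirtinger_onI:
  assumes "continuous_on S p" "continuous_on S q"
    and "\<And>z. z \<in> S \<Longrightarrow> (f has_derivative (\<lambda>v. p z * v + q z * cnj v)) (at z)"
  shows "has_wirtinger_on f p q S"
  using assms by (simp add: has_wirtinger_on_def)

lemma has_wirtinger_on_continuous:
  assumes "has_wirtinger_on f p q S"
  shows "continuous_on S f" "continuous_on S p" "continuous_on S q"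
  using assms by (auto simp: has_wirtinger_on_def intro!: continuous_at_imp_continuous_on has_derivative_continuous)

lemma has_wirtinger_on_derivative:
  assumes "has_wirtinger_on f p q S" "z \<in> S"
  shows "(f has_derivative (\<lambda>v. p z * v + q z * cnj v)) (at z)"
  using assms by (simp add: has_wirtinger_on_def)

lemma has_wirtinger_on_cong:
  assumes "has_wirtinger_on f p q S"
    and "\<And>z. z \<in> S \<Longrightarrow> p z = p' z" "\<And>z. z \<in> S \<Longrightarrow> q z = q' z"
  shows "has_wirtinger_on f p' q' S"
  using assms by (auto simp: has_wirtinger_on_def cong: continuous_on_cong)

lemma has_wirtinger_on_const: "has_wirtinger_on (\<lambda>z. c) (\<lambda>z. 0) (\<lambda>z. 0) S"
  by (intro has_wirtinger_onI) (auto intro!: derivative_eq_intros)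

lemma has_wirtinger_on_add:
  assumes "has_wirtinger_on f p q S" "has_wirtinger_on g r s S"
  shows "has_wirtinger_on (\<lambda>z. f z + g z) (\<lambda>z. p z + r z) (\<lambda>z. q z + s z) S"
  using has_wirtinger_on_continuous[OF assms(1)] has_wirtinger_on_continuous[OF assms(2)]
    assms[THEN has_wirtinger_on_derivative]
  by (intro has_wirtinger_onI)
     (auto intro!: continuous_intros derivative_eq_intros simp: algebra_simps)

lemma has_wirtinger_on_mult:
  assumes "has_wirtinger_on f p q S" "has_wirtinger_on g r s S"
  shows "has_wirtinger_on (\<lambda>z. f z * g z) (\<lambda>z. p z * g z + f z * r z) (\<lambda>z. q z * g z + f z * s z) S"
  using has_wirtinger_on_continuous[OF assms(1)] has_wirtinger_on_continuous[OF assms(2)]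
    assms[THEN has_wirtinger_on_derivative]
  by (intro has_wirtinger_onI)
     (auto intro!: continuous_intros derivative_eq_intros simp: algebra_simps)

lemma has_wirtinger_on_cnj:
  assumes "has_wirtinger_on f p q S"
  shows "has_wirtinger_on (\<lambda>z. cnj (f z)) (\<lambda>z. cnj (q z)) (\<lambda>z. cnj (p z)) S"
proof (intro has_wirtinger_onI)
  fix z assume "z \<in> S"
  from has_derivative_cnj[OF has_wirtinger_on_derivative[OF assms this]]
  show "((\<lambda>z. cnj (f z)) has_derivative (\<lambda>v. cnj (q z) * v + cnj (p z) * cnj v)) (at z)"
    by (simp add: add.commute)
qed (use has_wirtinger_on_continuous[OF assms] in \<open>auto intro!: continuous_intros\<close>)

text \<open>The derivative of \<open>G\<close> is multiplication by a complex number, so the chain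
  rule just scales both coefficients. It serves for \<open>inverse\<close> and
  \<open>csqrt\<close>.\<close>

lemma has_wirtinger_on_compose_holomorphic:
  assumes f: "has_wirtinger_on f p q S" and G: "G holomorphic_on T" "open T" "f ` S \<subseteq> T"
  shows "has_wirtinger_on (\<lambda>z. G (f z)) (\<lambda>z. deriv G (f z) * p z) (\<lambda>z. deriv G (f z) * q z) S"
proof (intro has_wirtinger_onI)
  fix z assume z: "z \<in> S"
  have "(G has_derivative (\<lambda>v. deriv G (f z) * v)) (at (f z))"
    using holomorphic_derivI[OF G(1,2)] z G(3) by (auto simp: has_field_derivative_def)
  from has_derivative_compose[OF has_wirtinger_on_derivative[OF f z] this]
  show "((\<lambda>z. G (f z)) has_derivative (\<lambda>v. deriv G (f z) * p z * v + deriv G (f z) * q z * cnj v)) (at z)"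
    by (simp add: algebra_simps)
next
  have "continuous_on T (deriv G)"
    by (intro holomorphic_on_imp_continuous_on holomorphic_deriv G)
  then have "continuous_on S (\<lambda>z. deriv G (f z))"
    using has_wirtinger_on_continuous(1)[OF f] G(3) by (rule continuous_on_compose2)
  then show "continuous_on S (\<lambda>z. deriv G (f z) * p z)" "continuous_on S (\<lambda>z. deriv G (f z) * q z)"
    using has_wirtinger_on_continuous[OF f] by (auto intro!: continuous_intros)
qed

lemma has_wirtinger_on_holomorphic:
  assumes "f holomorphic_on S" "open S"
  shows "has_wirtinger_on f (deriv f) (\<lambda>z. 0) S"
proof (intro has_wirtinger_onI)
  show "(f has_derivative (\<lambda>v. deriv f z * v + 0 * cnj v)) (at z)" if "z \<in> S" for z
    using holomorphic_derivI[OF assms that] by (simp add: has_field_derivative_def)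
qed (use assms in \<open>auto intro!: holomorphic_on_imp_continuous_on holomorphic_deriv\<close>)

lemma has_wirtinger_on_inverse:
  assumes f: "has_wirtinger_on f p q S" and nz: "\<And>z. z \<in> S \<Longrightarrow> f z \<noteq> 0"
  shows "has_wirtinger_on (\<lambda>z. inverse (f z)) (\<lambda>z. - p z / (f z)\<^sup>2) (\<lambda>z. - q z / (f z)\<^sup>2) S"
proof -
  have "has_wirtinger_on (\<lambda>z. inverse (f z)) (\<lambda>z. deriv inverse (f z) * p z) (\<lambda>z. deriv inverse (f z) * q z) S"
    by (rule has_wirtinger_on_compose_holomorphic[OF f, of _ "- {0}"])
       (use nz in \<open>auto intro!: holomorphic_intros\<close>)
  moreover have "deriv inverse (f z) = - 1 / (f z)\<^sup>2" if "z \<in> S" for z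
    by (rule DERIV_imp_deriv) 
       (use nz[OF that] in \<open>auto intro!: derivative_eq_intros simp: power2_eq_square field_simps\<close>)
  ultimately show ?thesis
    by (elim has_wirtinger_on_cong) simp_all
qed

text \<open>A real-linear map of the plane is determined by its values at \<open>1\<close> and
  \<open>\<i>\<close>. Rewriting it in terms of \<open>v\<close> and \<open>cnj v\<close> turns the
  partial derivatives into the Wirtinger derivatives.\<close>

lemma has_wirtinger_on_Ck_on:
  assumes "Ck_on (Suc 0) S f"
  shows "has_wirtinger_on f (wirtinger f) (wirtinger_bar f) S"
proof (intro has_wirtinger_onI)
  have "continuous_on S (\<lambda>z. frechet_derivative f (at z) v)" for v
    using assms by simp
  then show "continuous_on S (wirtinger f)" "continuous_on S (wirtinger_bar f)"
    unfolding wirtinger_def[abs_def] wirtinger_bar_def[abs_def] partial_x_def partial_y_def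
    by (auto intro!: continuous_intros)
  fix z assume "z \<in> S"
  then have d: "(f has_derivative frechet_derivative f (at z)) (at z)"
    using assms by (simp add: frechet_derivative_works[symmetric])
  interpret linear "frechet_derivative f (at z)"
    using has_derivative_linear[OF d] .
  have "frechet_derivative f (at z) v = wirtinger f z * v + wirtinger_bar f z * cnj v" for v
  proof -
    have "v = Re v *\<^sub>R 1 + Im v *\<^sub>R \<i>" by (simp add: complex_eq_iff)
    then have "frechet_derivative f (at z) v = Re v *\<^sub>R partial_x f z + Im v *\<^sub>R partial_y f z"
      unfolding partial_x_def partial_y_def by (metis add scale)
    also have "\<dots> = wirtinger f z * v + wirtinger_bar f z * cnj v"
      by (simp add: wirtinger_def wirtinger_bar_def complex_eq_iff field_simps)
    finally show ?thesis .
  qed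
  then have "frechet_derivative f (at z) = (\<lambda>v. wirtinger f z * v + wirtinger_bar f z * cnj v)"
    by auto
  with d show "(f has_derivative (\<lambda>v. wirtinger f z * v + wirtinger_bar f z * cnj v)) (at z)"
    by simp
qed

text \<open>Both Wirtinger derivatives are constant combinations of the derivatives in the
  directions \<open>1\<close> and \<open>\<i>\<close>, which are again continuously differentiable.
  Existence of the second derivatives is enough: the one relation needed between them is
  \<open>wirtinger_commute\<close>.\<close>

lemma Ck_on_wirtinger:
  assumes "Ck_on (Suc (Suc 0)) S f"
  obtains p1 p2 q1 q2 where "has_wirtinger_on (wirtinger f) p1 p2 S"
    "has_wirtinger_on (wirtinger_bar f) q1 q2 S"
proof -
  define g where "g v z = frechet_derivative f (at z) v" for v z
  have "Ck_on (Suc 0) S (g v)" for v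
    using assms by (simp add: g_def[abs_def])
  note g = has_wirtinger_on_Ck_on[OF this]
  have eq: "wirtinger f = (\<lambda>z. 1/2 * g 1 z + - \<i>/2 * g \<i> z)" "wirtinger_bar f = (\<lambda>z. 1/2 * g 1 z + \<i>/2 * g \<i> z)"
    by (auto simp: wirtinger_def wirtinger_bar_def partial_x_def partial_y_def g_def field_simps)
  note cg = has_wirtinger_on_mult[OF has_wirtinger_on_const g]
  show ?thesis
    using has_wirtinger_on_add[OF cg cg, of "1/2" 1 "- \<i>/2" \<i>]
      has_wirtinger_on_add[OF cg cg, of "1/2" 1 "\<i>/2" \<i>]
    unfolding eq[symmetric] by (rule that)
qed

text \<open>The derivative of \<open>f\<close> in direction \<open>1\<close> is \<open>p + q\<close>
  and in direction \<open>\<i>\<close> it is \<open>\<i> (p - q)\<close>. Equality of the two mixed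
  derivatives reduces to the claim after cancellation of \<open>p1\<close> and
  \<open>q2\<close>.\<close>

lemma wirtinger_commute:
  assumes "open S" "z \<in> S" and f: "has_wirtinger_on f p q S"
    and p: "has_wirtinger_on p p1 p2 S" and q: "has_wirtinger_on q q1 q2 S"
  shows "p2 z = q1 z"
proof -
  note c = has_wirtinger_on_continuous[OF p] has_wirtinger_on_continuous[OF q]
  have "(p1 z + q1 z) * \<i> + (p2 z + q2 z) * cnj \<i> = (p1 z - q1 z) * \<i> * 1 + (p2 z - q2 z) * \<i> * cnj 1"
  proof (rule second_derivative_symmetric[of S z f "\<lambda>z v. p z * v + q z * cnj v" 1
        "\<lambda>z v. (p1 z + q1 z) * v + (p2 z + q2 z) * cnj v" \<i>
        "\<lambda>z v. (p1 z - q1 z) * \<i> * v + (p2 z - q2 z) * \<i> * cnj v"])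
    fix x assume x: "x \<in> S"
    note d = has_wirtinger_on_derivative[OF p x] has_wirtinger_on_derivative[OF q x]
    show "((\<lambda>x. p x * 1 + q x * cnj 1) has_derivative (\<lambda>v. (p1 x + q1 x) * v + (p2 x + q2 x) * cnj v)) (at x)"
      using d by (auto intro!: derivative_eq_intros simp: algebra_simps)
    show "((\<lambda>x. p x * \<i> + q x * cnj \<i>) has_derivative (\<lambda>v. (p1 x - q1 x) * \<i> * v + (p2 x - q2 x) * \<i> * cnj v)) (at x)"
      using d by (auto intro!: derivative_eq_intros simp: algebra_simps)
  qed (use assms c in \<open>auto intro!: continuous_intros has_wirtinger_on_derivative\<close>)
  then have "\<i> * (2 * (p2 z - q1 z)) = 0" by (simp add: algebra_simps)
  then show ?thesis by simp
qed

section \<open>Integration by parts for Wirtinger derivatives\<close>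

text \<open>\<open>S - K\<close> is open and \<open>f\<close> is zero there, so its derivative is
  the zero map; evaluating at \<open>1\<close> and \<open>\<i>\<close> recovers the two
  coefficients.\<close>

lemma has_wirtinger_on_eq_0:
  assumes f: "has_wirtinger_on f p q S" and S: "open S" and K: "closed K"
    and zero: "\<And>z. z \<in> S - K \<Longrightarrow> f z = 0" and z: "z \<in> S - K"
  shows "p z = 0" "q z = 0"
proof -
  have "(f has_derivative (\<lambda>v. 0)) (at z)"
    by (rule has_derivative_transform_within_open[of "\<lambda>z. 0" _ _ _ "S - K"])
       (use z zero S K in \<open>auto simp: open_Diff\<close>)
  then have "(\<lambda>v. p z * v + q z * cnj v) = (\<lambda>v. 0)"
    using has_derivative_unique has_wirtinger_on_derivative[OF f] z by blast
  from fun_cong[OF this, of 1] fun_cong[OF this, of \<i>]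
  have "p z + q z = 0" "\<i> * (p z - q z) = 0" by (auto simp: algebra_simps)
  then show "p z = 0" "q z = 0" by auto
qed

text \<open>Extended by zero, \<open>f\<close> is differentiable on the whole plane with bounded
  derivative, so \<open>integral_derivative_compact_support\<close> applies. The directions
  \<open>1\<close> and \<open>\<i>\<close> show that the sum and the difference of the two integrals
  vanish. Applied to products, this is integration by parts.\<close>

lemma wirtinger_integral_eq_0:
  assumes f: "has_wirtinger_on f p q S" and S: "open S" and K: "compact K" "K \<subseteq> S"
    and zero: "\<And>z. z \<in> S - K \<Longrightarrow> f z = 0"
  shows "(LINT z:S|lborel. p z) = 0" "(LINT z:S|lborel. q z) = 0"
proof -
  note zero' = has_wirtinger_on_eq_0[OF f S compact_imp_closed[OF K(1)] zero]
  note cont = has_wirtinger_on_continuous[OF f]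
  define P Q where "P z = indicator S z *\<^sub>R p z" and "Q z = indicator S z *\<^sub>R q z" for z
  define g where "g z = (if z \<in> S then f z else 0)" for z
  have int: "integrable lborel P" "integrable lborel Q"
    unfolding P_def[abs_def] Q_def[abs_def] set_integrable_def[symmetric]
    using zero' by (auto intro!: integrable_continuous_compact_support[OF _ K] cont)
  have "bounded (p ` K)" "bounded (q ` K)"
    using K cont by (auto intro!: compact_imp_bounded compact_continuous_image intro: continuous_on_subset)
  then obtain B B' where B: "\<And>z. z \<in> K \<Longrightarrow> norm (p z) \<le> B" "\<And>z. z \<in> K \<Longrightarrow> norm (q z) \<le> B'"
    by (auto simp: bounded_iff)
  have bound: "norm (P z) \<le> \<bar>B\<bar>" "norm (Q z) \<le> \<bar>B'\<bar>" for z
    using B[of z] zero'[of z] by (cases "z \<in> K"; force simp: P_def Q_def indicator_def)+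
  have "(LINT z|lborel. P z * v + Q z * cnj v) = 0" for v
  proof (rule integral_derivative_compact_support[of g "\<lambda>z v. P z * v + Q z * cnj v" "\<bar>B\<bar> + \<bar>B'\<bar>" K v])
    \<comment> \<open>The open sets \<open>S\<close> and \<open>- K\<close> cover the plane;
      \<open>g\<close> is \<open>f\<close> on the first and zero on the second.\<close>
    show "(g has_derivative (\<lambda>v. P z * v + Q z * cnj v)) (at z)" for z
    proof (cases "z \<in> S")
      case True
      show ?thesis
        by (rule has_derivative_transform_within_open[of f _ _ _ S])
          (use True S has_wirtinger_on_derivative[OF f True] in \<open>auto simp: P_def Q_def g_def\<close>)
    next
      case False
      have "(g has_derivative (\<lambda>v. 0)) (at z)"
        by (rule has_derivative_transform_within_open[of "\<lambda>z. 0" _ _ _ "- K"])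
          (use False K zero in \<open>auto simp: g_def compact_imp_closed open_Compl\<close>)
      then show ?thesis using False by (simp add: P_def Q_def)
    qed
    show "onorm (\<lambda>v. P z * v + Q z * cnj v) \<le> \<bar>B\<bar> + \<bar>B'\<bar>" for z
    proof (rule onorm_le)
      fix v
      have "norm (P z * v + Q z * cnj v) \<le> norm (P z) * norm v + norm (Q z) * norm v"
        using norm_triangle_ineq[of "P z * v" "Q z * cnj v"] by (simp add: norm_mult)
      also have "\<dots> \<le> (\<bar>B\<bar> + \<bar>B'\<bar>) * norm v"
        using bound[of z] by (simp add: distrib_right add_mono mult_right_mono)
      finally show "norm (P z * v + Q z * cnj v) \<le> (\<bar>B\<bar> + \<bar>B'\<bar>) * norm v" .
    qed
  qed (use K zero in \<open>auto simp: g_def\<close>)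
  then have "(LINT z|lborel. P z) * v + (LINT z|lborel. Q z) * cnj v = 0" for v
    using int by simp
  from this[of 1] this[of \<i>]
  have "(LINT z|lborel. P z) + (LINT z|lborel. Q z) = 0" "\<i> * ((LINT z|lborel. P z) - (LINT z|lborel. Q z)) = 0"
    by (auto simp: algebra_simps)
  then show "(LINT z:S|lborel. p z) = 0" "(LINT z:S|lborel. q z) = 0"
    by (auto simp: set_lebesgue_integral_def P_def Q_def)
qed

section \<open>The weighted L2 inequality\<close>

text \<open>Here \<open>a\<close> is the \<open>z\<close>-derivative of \<open>log w\<close>, and \<open>b \<ge> 0\<close> says that \<open>log w\<close> is subharmonic.\<close>

lemma weighted_wirtinger_integral_le:
  assumes S: "open S" and K: "compact K" "K \<subseteq> S" and zero: "\<And>z. z \<in> S - K \<Longrightarrow> \<eta> z = 0"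
    and \<eta>: "has_wirtinger_on \<eta> p q S"
    and p: "has_wirtinger_on p p1 p2 S" and q: "has_wirtinger_on q q1 q2 S"
    and w: "has_wirtinger_on (\<lambda>z. complex_of_real (w z)) (\<lambda>z. w z * a z) (\<lambda>z. w z * cnj (a z)) S"
    and a: "has_wirtinger_on a a1 (\<lambda>z. complex_of_real (b z)) S"
    and nonneg: "\<And>z. z \<in> S \<Longrightarrow> w z \<ge> 0" "\<And>z. z \<in> S \<Longrightarrow> b z \<ge> 0"
  shows "(LINT z:S|lborel. w z * (cmod (p z + a z * \<eta> z))\<^sup>2) \<le> (LINT z:S|lborel. w z * (cmod (q z))\<^sup>2)"
proof -
  \<comment> \<open>\<open>w z * D z\<close> is the \<open>z\<close>-derivative of
    \<open>w \<eta>\<close>, so up to sign this is the formal adjoint of the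
    \<open>cnj z\<close>-derivative in the L2 space with weight \<open>w\<close>, applied to
    \<open>\<eta>\<close>.\<close>
  define D where "D z = p z + a z * \<eta> z" for z
  have D: "has_wirtinger_on D (\<lambda>z. p1 z + (a1 z * \<eta> z + a z * p z)) (\<lambda>z. p2 z + (b z * \<eta> z + a z * q z)) S"
    unfolding D_def[abs_def] by (intro has_wirtinger_on_add has_wirtinger_on_mult p a \<eta>)
  note P = has_wirtinger_on_mult[OF has_wirtinger_on_mult[OF w \<eta>] has_wirtinger_on_cnj[OF D]]
  note Q = has_wirtinger_on_mult[OF has_wirtinger_on_mult[OF w \<eta>] has_wirtinger_on_cnj[OF q]]
  note zero' = has_wirtinger_on_eq_0[OF \<eta> S compact_imp_closed[OF K(1)] zero]
  have D0: "D z = 0" if "z \<in> S - K" for z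
    using that zero zero' by (simp add: D_def)
  have cw: "continuous_on S w"
    using continuous_on_Re[OF has_wirtinger_on_continuous(1)[OF w]] by simp
  have cb: "continuous_on S b"
    using continuous_on_Re[OF has_wirtinger_on_continuous(3)[OF a]] by simp
  note cont = cw cb has_wirtinger_on_continuous[OF \<eta>] has_wirtinger_on_continuous(1)[OF D]
  have int: "set_integrable lborel S (\<lambda>z. w z * (cmod (D z))\<^sup>2)"
      "set_integrable lborel S (\<lambda>z. w z * b z * (cmod (\<eta> z))\<^sup>2)"
      "set_integrable lborel S (\<lambda>z. w z * (cmod (q z))\<^sup>2)"
    using zero zero' D0 
    by (auto intro!: integrable_continuous_compact_support[OF _ K] continuous_intros cont)
  \<comment> \<open>\<open>P1\<close> and \<open>Q2\<close> are the \<open>z\<close>-derivative of \<open>w \<eta> cnj D\<close> and the \<open>cnj z\<close>-derivative of \<open>w \<eta> cnj q\<close>\<close>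
  define P1 where "P1 z = (w z * a z * \<eta> z + w z * p z) * cnj (D z) + w z * \<eta> z * cnj (p2 z + (b z * \<eta> z + a z * q z))" for z
  define Q2 where "Q2 z = (w z * cnj (a z) * \<eta> z + w z * q z) * cnj (q z) + w z * \<eta> z * cnj (q1 z)" for z
  have intPQ: "set_integrable lborel S P1" "set_integrable lborel S Q2"
    unfolding P1_def[abs_def] Q2_def[abs_def]
    by (rule integrable_continuous_compact_support[OF has_wirtinger_on_continuous(2)[OF P] K],
          simp add: zero[simplified] D0[simplified])
       (rule integrable_continuous_compact_support[OF has_wirtinger_on_continuous(3)[OF Q] K],
          simp add: zero[simplified] zero'(2)[simplified])
  have "(LINT z:S|lborel. P1 z) = 0"
    unfolding P1_def by (rule wirtinger_integral_eq_0(1)[OF P S K]) (simp add: zero)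
  moreover have "(LINT z:S|lborel. Q2 z) = 0"
    unfolding Q2_def by (rule wirtinger_integral_eq_0(2)[OF Q S K]) (simp add: zero)
  ultimately have "0 = (LINT z:S|lborel. P1 z - Q2 z)"
    using intPQ by simp
  also have "\<dots> = (LINT z:S|lborel. complex_of_real (w z * (cmod (D z))\<^sup>2 + w z * b z * (cmod (\<eta> z))\<^sup>2 - w z * (cmod (q z))\<^sup>2))"
  proof (rule set_lebesgue_integral_cong)
    show "\<forall>z. z \<in> S \<longrightarrow> P1 z - Q2 z =
        complex_of_real (w z * (cmod (D z))\<^sup>2 + w z * b z * (cmod (\<eta> z))\<^sup>2 - w z * (cmod (q z))\<^sup>2)"
    proof (intro allI impI)
      fix z assume "z \<in> S"
      \<comment> \<open>By this equality the second derivatives of \<open>\<eta>\<close> cancel in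
        \<open>P1 - Q2\<close>. The terms \<open>w \<eta> cnj (a q)\<close> occur in both and cancel
        too, so that only \<open>b\<close> remains from the commutator.\<close>
      then have "p2 z = q1 z" using wirtinger_commute[OF S _ \<eta> p q] by blast
      then show "P1 z - Q2 z =
        complex_of_real (w z * (cmod (D z))\<^sup>2 + w z * b z * (cmod (\<eta> z))\<^sup>2 - w z * (cmod (q z))\<^sup>2)"
        by (simp add: P1_def Q2_def D_def complex_norm_square algebra_simps del: of_real_power)
    qed
  qed (use S in auto)
  finally have "complex_of_real (LINT z:S|lborel. w z * (cmod (D z))\<^sup>2 + w z * b z * (cmod (\<eta> z))\<^sup>2 - w z * (cmod (q z))\<^sup>2) = 0"
    unfolding set_integral_complex_of_real by (rule sym)
  then have "(LINT z:S|lborel. w z * (cmod (D z))\<^sup>2 + w z * b z * (cmod (\<eta> z))\<^sup>2 - w z * (cmod (q z))\<^sup>2) = 0"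
    by (rule of_real_eq_0_iff[THEN iffD1])
  moreover have "(LINT z:S|lborel. w z * (cmod (D z))\<^sup>2 + w z * b z * (cmod (\<eta> z))\<^sup>2 - w z * (cmod (q z))\<^sup>2)
      = (LINT z:S|lborel. w z * (cmod (D z))\<^sup>2) + (LINT z:S|lborel. w z * b z * (cmod (\<eta> z))\<^sup>2)
      - (LINT z:S|lborel. w z * (cmod (q z))\<^sup>2)"
    by (simp only: set_integral_diff set_integral_add int)
  ultimately have "(LINT z:S|lborel. w z * (cmod (D z))\<^sup>2) + (LINT z:S|lborel. w z * b z * (cmod (\<eta> z))\<^sup>2)
      = (LINT z:S|lborel. w z * (cmod (q z))\<^sup>2)"
    by linarith
  \<comment> \<open>Subharmonicity of \<open>log w\<close> enters here: dropping this term turns the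
    identity into the inequality.\<close>
  moreover have "(LINT z:S|lborel. w z * b z * (cmod (\<eta> z))\<^sup>2) \<ge> 0"
    unfolding set_lebesgue_integral_def
    by (rule Bochner_Integration.integral_nonneg) (use nonneg in \<open>auto simp: indicator_def\<close>)
  ultimately show ?thesis by (simp add: D_def)
qed

section \<open>The inequality for the regularized weight\<close>

text \<open>Replacing \<open>p\<close> by \<open>D = p + a \<eta>\<close>, with \<open>a\<close> the
  \<open>z\<close>-derivative of \<open>log w\<close>, changes \<open>H p q\<close> by
  \<open>H a \<eta> q\<close>. Here \<open>H a\<close> is \<open>H' / 2\<close> times
  \<open>1 - e / (|H|^2 + e)\<close>: the first part integrates to zero and the second is the error
  term. What remains, \<open>H D q\<close>, is controlled by the weighted inequality because
  \<open>|H| \<le> w\<close>.\<close>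

lemma regularized_inequality:
  fixes e :: real
  assumes S: "open S" and K: "compact K" "K \<subseteq> S" and zero: "\<And>z. z \<in> S - K \<Longrightarrow> \<eta> z = 0"
    and \<eta>: "has_wirtinger_on \<eta> p q S"
    and p: "has_wirtinger_on p p1 p2 S" and q: "has_wirtinger_on q q1 q2 S"
    and H: "H holomorphic_on S" and e: "e > 0"
  shows "cmod (LINT z:S|lborel. H z * p z * q z) \<le>
    (LINT z:S|lborel. sqrt ((cmod (H z))\<^sup>2 + e) * (cmod (q z))\<^sup>2) +
    (LINT z:S|lborel. cmod (deriv H z * \<eta> z * q z) * (e / ((cmod (H z))\<^sup>2 + e))) / 2"
proof -
  define H' where "H' = deriv H"
  have H': "H' holomorphic_on S" unfolding H'_def by (intro holomorphic_deriv H S)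
  define r where "r z = (cmod (H z))\<^sup>2 + e" for z
  define w where "w z = sqrt (r z)" for z
  \<comment> \<open>The complex-valued copy of \<open>r\<close>, written with \<open>cnj\<close> so
    that the product rule for Wirtinger derivatives applies.\<close>
  define s where "s z = H z * cnj (H z) + complex_of_real e" for z
  \<comment> \<open>With \<open>log w = (log s) / 2\<close>, these formulas for \<open>a\<close> and
    \<open>b\<close> are its \<open>z\<close>-derivative and its mixed second derivative.\<close>
  define a where "a z = 1 / 2 * H' z * cnj (H z) * inverse (s z)" for z
  define b where "b z = (cmod (H' z))\<^sup>2 * e / (2 * (r z)\<^sup>2)" for z
  have r: "r z > 0" for z using e by (simp add: r_def add_nonneg_pos)
  have s_r: "s z = complex_of_real (r z)" for z
    by (simp add: s_def r_def complex_norm_square del: of_real_power)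
  have w0: "w z > 0" for z using r by (simp add: w_def)
  \<comment> \<open>As \<open>s\<close> takes positive real values, \<open>w\<close> is the
    composition of \<open>s\<close> with a function holomorphic off the nonpositive reals.\<close>
  have w_csqrt: "complex_of_real (w z) = csqrt (s z)" for z
    using r[of z] by (simp add: w_def s_r)
  have w2: "complex_of_real (w z) * complex_of_real (w z) = s z" for z
    using r[of z] by (simp add: w_def s_r flip: of_real_mult)
  note HH = has_wirtinger_on_holomorphic[OF H S, folded H'_def]
  note HH' = has_wirtinger_on_holomorphic[OF H' S]
  have s_pre: "has_wirtinger_on s (\<lambda>z. H' z * cnj (H z) + H z * cnj 0 + 0) (\<lambda>z. 0 * cnj (H z) + H z * cnj (H' z) + 0) S"
    unfolding s_def[abs_def]
    by (intro has_wirtinger_on_add has_wirtinger_on_mult has_wirtinger_on_cnj has_wirtinger_on_const HH)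
  have s: "has_wirtinger_on s (\<lambda>z. H' z * cnj (H z)) (\<lambda>z. H z * cnj (H' z)) S"
    by (rule has_wirtinger_on_cong[OF s_pre]) simp_all
  have nonreal: "s z \<notin> \<real>\<^sub>\<le>\<^sub>0" for z
    using r[of z] by (simp add: s_r)
  have "has_wirtinger_on (\<lambda>z. csqrt (s z)) (\<lambda>z. deriv csqrt (s z) * (H' z * cnj (H z)))
      (\<lambda>z. deriv csqrt (s z) * (H z * cnj (H' z))) S"
    by (rule has_wirtinger_on_compose_holomorphic[OF s, of _ "- \<real>\<^sub>\<le>\<^sub>0"])
       (use nonreal in \<open>auto intro!: holomorphic_intros\<close>)
  then have w: "has_wirtinger_on (\<lambda>z. complex_of_real (w z)) (\<lambda>z. w z * a z) (\<lambda>z. w z * cnj (a z)) S"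
    unfolding w_csqrt[symmetric]
  proof (rule has_wirtinger_on_cong)
    fix z
    have d: "deriv csqrt (s z) = inverse (2 * complex_of_real (w z))"
      unfolding w_csqrt by (rule DERIV_imp_deriv, rule has_field_derivative_csqrt[OF nonreal])
    have nz: "complex_of_real (w z) \<noteq> 0" using w0[of z] by simp
    show "deriv csqrt (s z) * (H' z * cnj (H z)) = w z * a z"
      unfolding d unfolding a_def w2[symmetric] using nz by (simp add: field_simps)
    show "deriv csqrt (s z) * (H z * cnj (H' z)) = w z * cnj (a z)"
      unfolding d unfolding a_def w2[symmetric] using nz by (simp add: field_simps)
  qed
  obtain a1 where a: "has_wirtinger_on a a1 (\<lambda>z. complex_of_real (b z)) S"
  proof -
    note X = has_wirtinger_on_mult[OF has_wirtinger_on_mult[OF has_wirtinger_on_mult[OF has_wirtinger_on_const[of "1/2"] HH'] has_wirtinger_on_cnj[OF HH]]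
        has_wirtinger_on_inverse[OF s]]
    have nz: "s z \<noteq> 0" for z using r[of z] by (simp add: s_r)
    show ?thesis
    proof (rule that, unfold a_def[abs_def], rule has_wirtinger_on_cong[OF X refl])
      fix z
      \<comment> \<open>The product and quotient rules leave \<open>s - H cnj H\<close> in the
        numerator, which is \<open>e\<close>; hence \<open>b\<close> is nonnegative.\<close>
      have "complex_of_real (b z) = H' z * cnj (H' z) * (s z - H z * cnj (H z)) / (2 * (s z)\<^sup>2)"
      proof -
        have "b z = (cmod (H' z))\<^sup>2 * (r z - (cmod (H z))\<^sup>2) / (2 * (r z)\<^sup>2)"
          by (simp add: b_def r_def)
        then show ?thesis
          by (simp add: s_r complex_norm_square[symmetric])
      qed
      then show "((0 * H' z + 1 / 2 * 0) * cnj (H z) + 1 / 2 * H' z * cnj (H' z)) * inverse (s z) +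
          1 / 2 * H' z * cnj (H z) * (- (H z * cnj (H' z)) / (s z)\<^sup>2) = complex_of_real (b z)"
        using nz[of z] by (simp add: field_simps power2_eq_square)
    qed (use nz in auto)
  qed
  have main: "(LINT z:S|lborel. w z * (cmod (p z + a z * \<eta> z))\<^sup>2) \<le> (LINT z:S|lborel. w z * (cmod (q z))\<^sup>2)"
    by (rule weighted_wirtinger_integral_le[OF S K zero \<eta> p q w a])
       (use w0 e in \<open>auto simp: b_def less_imp_le\<close>)
  define D where "D z = p z + a z * \<eta> z" for z
  note zero' = has_wirtinger_on_eq_0[OF \<eta> S compact_imp_closed[OF K(1)] zero]
  have cw: "continuous_on S w"
    using continuous_on_Re[OF has_wirtinger_on_continuous(1)[OF w]] by simp
  have cH: "continuous_on S H" "continuous_on S H'"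
    using H H' by (auto intro: holomorphic_on_imp_continuous_on)
  have cr: "continuous_on S r" 
    unfolding r_def[abs_def] by (intro continuous_intros cH)
  note cont = cw cr cH has_wirtinger_on_continuous[OF \<eta>] has_wirtinger_on_continuous(1)[OF a]
  have rnz: "r z \<noteq> 0" for z using r[of z] by simp
  note integrable = integrable_continuous_compact_support[OF _ K]
  \<comment> \<open>As \<open>H'\<close> is holomorphic, the integrand is half the
    \<open>cnj z\<close>-derivative of \<open>H' \<eta>^2\<close>.\<close>
  have cross: "(LINT z:S|lborel. H' z * \<eta> z * q z) = 0"
  proof -
    note X = has_wirtinger_on_mult[OF HH' has_wirtinger_on_mult[OF \<eta> \<eta>]]
    have "(LINT z:S|lborel. 0 * (\<eta> z * \<eta> z) + H' z * (q z * \<eta> z + \<eta> z * q z)) = 0"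
      by (rule wirtinger_integral_eq_0(2)[OF X S K]) (simp add: zero)
    also have "(\<lambda>z. 0 * (\<eta> z * \<eta> z) + H' z * (q z * \<eta> z + \<eta> z * q z)) = (\<lambda>z. 2 * (H' z * \<eta> z * q z))"
      by (auto simp: algebra_simps)
    finally show ?thesis by (simp add: set_integral_mult_right)
  qed
  define R where "R z = H' z * \<eta> z * q z * complex_of_real (e / r z)" for z
  have intR: "set_integrable lborel S R" 
    unfolding R_def[abs_def]
    by (rule integrable) (use zero rnz in \<open>auto intro!: continuous_intros cont\<close>)
  have intD: "set_integrable lborel S (\<lambda>z. H z * D z * q z)"
    unfolding D_def
    by (rule integrable) (use zero zero' in \<open>auto intro!: continuous_intros cont\<close>)
  have intC: "set_integrable lborel S (\<lambda>z. H' z * \<eta> z * q z)"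
    by (rule integrable) (use zero in \<open>auto intro!: continuous_intros cont\<close>)
  have split: "H z * p z * q z = (H z * D z * q z - 1/2 * (H' z * \<eta> z * q z)) + 1/2 * R z" for z
  proof -
    have nz: "s z \<noteq> 0" using r[of z] by (simp add: s_r)
    have "H z * a z = 1/2 * H' z * (s z - e) * inverse (s z)"
      by (simp add: a_def s_def)
    also have "\<dots> = 1/2 * H' z * (1 - complex_of_real (e / r z))"
      using nz by (simp add: s_r field_simps)
    finally have Ha: "H z * a z = 1/2 * H' z * (1 - complex_of_real (e / r z))" .
    have "H z * D z * q z = H z * p z * q z + H z * a z * \<eta> z * q z"
      by (simp add: D_def algebra_simps)
    then show ?thesis unfolding Ha R_def by (simp add: algebra_simps)
  qed
  have "(LINT z:S|lborel. H z * p z * q z) = (LINT z:S|lborel. H z * D z * q z) + 1/2 * (LINT z:S|lborel. R z)"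
    unfolding split by (simp only: set_integral_add set_integral_diff set_integral_mult_right set_integrable_mult_right intR intD intC cross) simp
  then have "cmod (LINT z:S|lborel. H z * p z * q z)
      \<le> cmod (LINT z:S|lborel. H z * D z * q z) + cmod (LINT z:S|lborel. R z) / 2"
    using norm_triangle_ineq[of "LINT z:S|lborel. H z * D z * q z" "1/2 * (LINT z:S|lborel. R z)"]
    by (simp add: norm_mult)
  moreover have "cmod (LINT z:S|lborel. R z) \<le> (LINT z:S|lborel. cmod (R z))"
    by (rule set_integral_norm_bound[OF intR])
  moreover have "cmod (R z) = cmod (deriv H z * \<eta> z * q z) * (e / ((cmod (H z))\<^sup>2 + e))" for z
  proof -
    have "cmod (complex_of_real (e / r z)) = e / r z"
      using r[of z] e by (simp only: norm_of_real) simp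
    then show ?thesis
      by (simp only: R_def norm_mult H'_def) (simp add: r_def)
  qed
  moreover have "cmod (LINT z:S|lborel. H z * D z * q z) \<le> (LINT z:S|lborel. w z * (cmod (q z))\<^sup>2)"
  proof -
    have int: "set_integrable lborel S (\<lambda>z. w z * (cmod (D z))\<^sup>2)" "set_integrable lborel S (\<lambda>z. w z * (cmod (q z))\<^sup>2)"
      unfolding D_def
      by (rule integrable; use zero zero' in \<open>auto intro!: continuous_intros cont\<close>)+
    have "cmod (LINT z:S|lborel. H z * D z * q z) \<le> (LINT z:S|lborel. cmod (H z * D z * q z))"
      by (rule set_integral_norm_bound[OF intD])
    also have "\<dots> \<le> (LINT z:S|lborel. 1/2 * (w z * (cmod (D z))\<^sup>2) + 1/2 * (w z * (cmod (q z))\<^sup>2))"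
    proof (rule set_integral_mono)
      show "set_integrable lborel S (\<lambda>z. cmod (H z * D z * q z))"
        using intD by (rule set_integrable_norm)
      show "set_integrable lborel S (\<lambda>z. 1/2 * (w z * (cmod (D z))\<^sup>2) + 1/2 * (w z * (cmod (q z))\<^sup>2))"
        by (intro set_integral_add(1) set_integrable_mult_right int)
      fix z
      \<comment> \<open>Together with \<open>2 |D| |q| \<le> |D|^2 + |q|^2\<close> this bounds the
        integrand by two halves with weight \<open>w\<close>; \<open>main\<close> then replaces the
        half with \<open>D\<close> by one with \<open>q\<close>.\<close>
      have "cmod (H z) \<le> w z" unfolding w_def r_def using e by (intro real_le_rsqrt) simp
      then have "cmod (H z) * (cmod (D z) * cmod (q z)) \<le> w z * (((cmod (D z))\<^sup>2 + (cmod (q z))\<^sup>2) / 2)"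
        using sum_squares_bound[of "cmod (D z)" "cmod (q z)"] w0[of z] by (intro mult_mono) auto
      then show "cmod (H z * D z * q z) \<le> 1/2 * (w z * (cmod (D z))\<^sup>2) + 1/2 * (w z * (cmod (q z))\<^sup>2)"
        by (simp add: norm_mult algebra_simps)
    qed
    also have "\<dots> = 1/2 * (LINT z:S|lborel. w z * (cmod (D z))\<^sup>2) + 1/2 * (LINT z:S|lborel. w z * (cmod (q z))\<^sup>2)"
      by (simp only: set_integral_add set_integral_mult_right set_integrable_mult_right int)
    finally show ?thesis using main by (simp add: D_def)
  qed
  ultimately show ?thesis by (simp add: w_def r_def)
qed

section \<open>Passage to the limit\<close>

text \<open>An open set is a countable union of compact sets, so a nonconstant holomorphic function
  on a connected one has countably many zeros, and countable sets are null. A constant function that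
  is nonzero at \<open>z0\<close> has no zeros.\<close>

lemma AE_holomorphic_nonzero:
  assumes S: "open S" "connected S" and H: "H holomorphic_on S" and nz: "z0 \<in> S" "H z0 \<noteq> 0"
  shows "AE z in lborel. z \<in> S \<longrightarrow> H z \<noteq> 0"
proof -
  have "countable {z \<in> S. H z = 0}"
  proof (cases "H constant_on S")
    case True
    then have "{z \<in> S. H z = 0} = {}"
      using nz by (auto simp: constant_on_def)
    then show ?thesis by (simp only: countable_empty)
  next
    case False
    obtain F :: "nat \<Rightarrow> complex set" where "range F \<subseteq> Collect compact" "S = \<Union>(range F)"
      using open_Union_compact_subsets[OF S(1)] by (metis image_subsetI mem_Collect_eq)
    then have "fsigma S"
      by (auto simp: fsigma_Union_compact)
    then show ?thesis
      using holomorphic_countable_zeros[OF H S] False by blast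
  qed
  then have "AE z in lborel. z \<notin> {z \<in> S. H z = 0}"
    by (intro AE_not_in countable_imp_null_set_lborel)
  then show ?thesis by auto
qed

text \<open>Dominated convergence is applied to both integrals of
  \<open>regularized_inequality\<close> along a null sequence \<open>e\<close>: the weight tends to
  \<open>|H|\<close> and the error term to zero. If \<open>H\<close> vanishes identically, the left
  side is zero; otherwise its zeros form a null set.\<close>

lemma weighted_wirtinger_product_le:
  assumes S: "open S" "connected S" and K: "compact K" "K \<subseteq> S"
    and zero: "\<And>z. z \<in> S - K \<Longrightarrow> \<eta> z = 0"
    and \<eta>: "has_wirtinger_on \<eta> p q S"
    and p: "has_wirtinger_on p p1 p2 S" and q: "has_wirtinger_on q q1 q2 S"
    and H: "H holomorphic_on S"
  shows "cmod (LINT z:S|lborel. H z * p z * q z) \<le> (LINT z:S|lborel. cmod (H z) * (cmod (q z))\<^sup>2)"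
proof (cases "\<forall>z\<in>S. H z = 0")
  case True
  then have "(LINT z:S|lborel. H z * p z * q z) = (LINT z:S|lborel. 0)"
    using S by (intro set_lebesgue_integral_cong) auto
  then show ?thesis
    by (simp add: set_lebesgue_integral_def)
next
  case False
  then have nz: "AE z in lborel. z \<in> S \<longrightarrow> H z \<noteq> 0"
    using AE_holomorphic_nonzero[OF S H] by blast
  \<comment> \<open>The bound \<open>e n \<le> 1\<close> makes \<open>w 1\<close> a dominating
    function.\<close>
  define e where "e n = 1 / real (Suc n)" for n
  have e: "e n > 0" "e n \<le> 1" for n by (auto simp: e_def)
  have e_lim: "e \<longlonglongrightarrow> 0"
    unfolding e_def[abs_def] using LIMSEQ_inverse_real_of_nat by (simp only: inverse_eq_divide)
  define w where "w t z = sqrt ((cmod (H z))\<^sup>2 + t) * (cmod (q z))\<^sup>2" for t z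
  define R where "R z = cmod (deriv H z * \<eta> z * q z)" for z
  \<comment> \<open>The factor in the error term: it is at most \<open>1\<close> and tends to zero
    where \<open>H\<close> is nonzero. At a zero of \<open>H\<close> it equals \<open>1\<close> for
    every \<open>n\<close>, hence convergence only almost everywhere.\<close>
  define c where "c n z = e n / ((cmod (H z))\<^sup>2 + e n)" for n z
  note zero' = has_wirtinger_on_eq_0[OF \<eta> S(1) compact_imp_closed[OF K(1)] zero]
  have cH: "continuous_on S H" "continuous_on S (deriv H)"
    using H S by (auto intro!: holomorphic_on_imp_continuous_on holomorphic_deriv)
  note cont = cH has_wirtinger_on_continuous[OF \<eta>]
  have pos: "(cmod (H z))\<^sup>2 + e n > 0" for n z
    using e(1)[of n] by (simp add: add_nonneg_pos)
  then have pos': "(cmod (H z))\<^sup>2 + e n \<noteq> 0" for n z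
    by (metis less_irrefl)
  have c: "0 \<le> c n z" "c n z \<le> 1" for n z
    using e(1)[of n] pos[of z n] by (auto simp: c_def)
  have int_w: "set_integrable lborel S (w t)" for t
    unfolding w_def[abs_def]
    by (rule integrable_continuous_compact_support[OF _ K])
       (use zero' in \<open>auto intro!: continuous_intros cont\<close>)
  have int_R: "set_integrable lborel S R"
    unfolding R_def[abs_def]
    by (rule integrable_continuous_compact_support[OF _ K])
       (use zero in \<open>auto intro!: continuous_intros cont\<close>)
  have int_Rc: "set_integrable lborel S (\<lambda>z. R z * c n z)" for n
    unfolding R_def[abs_def] c_def
    by (rule integrable_continuous_compact_support[OF _ K])
       (use zero pos' in \<open>auto intro!: continuous_intros cont\<close>)
  have "(\<lambda>n. LINT z:S|lborel. w (e n) z) \<longlonglongrightarrow> (LINT z:S|lborel. w 0 z)"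
    unfolding set_lebesgue_integral_def
  proof (rule integral_dominated_convergence)
    show "integrable lborel (\<lambda>z. indicator S z *\<^sub>R w 1 z)"
      using int_w by (simp add: set_integrable_def)
    show "AE z in lborel. (\<lambda>n. indicator S z *\<^sub>R w (e n) z) \<longlonglongrightarrow> indicator S z *\<^sub>R w 0 z"
      unfolding w_def by (intro AE_I2 tendsto_intros e_lim)
    show "AE z in lborel. norm (indicator S z *\<^sub>R w (e n) z) \<le> indicator S z *\<^sub>R w 1 z" for n
    proof (intro AE_I2)
      fix z
      have "w (e n) z \<le> w 1 z" "0 \<le> w (e n) z"
        using e[of n] by (auto simp: w_def intro!: mult_right_mono)
      then show "norm (indicator S z *\<^sub>R w (e n) z) \<le> indicator S z *\<^sub>R w 1 z"
        by (simp add: indicator_def)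
    qed
  qed (use int_w in \<open>auto simp: set_integrable_def\<close>)
  moreover have "(\<lambda>n. LINT z:S|lborel. R z * c n z) \<longlonglongrightarrow> (LINT z:S|lborel. 0)"
    unfolding set_lebesgue_integral_def
  proof (rule integral_dominated_convergence)
    show "integrable lborel (\<lambda>z. indicator S z *\<^sub>R R z)"
      using int_R by (simp add: set_integrable_def)
    show "AE z in lborel. (\<lambda>n. indicator S z *\<^sub>R (R z * c n z)) \<longlonglongrightarrow> indicator S z *\<^sub>R 0"
      using nz
    proof eventually_elim
      case (elim z)
      show ?case
      proof (cases "z \<in> S")
        case True
        then have "(\<lambda>n. c n z) \<longlonglongrightarrow> 0 / ((cmod (H z))\<^sup>2 + 0)"
          unfolding c_def using elim by (intro tendsto_intros e_lim) auto
        then have "(\<lambda>n. R z * c n z) \<longlonglongrightarrow> 0"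
          using tendsto_mult_right_zero by fastforce
        then show ?thesis using True by simp
      qed simp
    qed
    show "AE z in lborel. norm (indicator S z *\<^sub>R (R z * c n z)) \<le> indicator S z *\<^sub>R R z" for n
    proof (intro AE_I2)
      fix z
      have "R z * c n z \<le> R z" "0 \<le> R z * c n z"
        using c[of n z] by (auto simp: R_def intro!: mult_left_le mult_nonneg_nonneg)
      then show "norm (indicator S z *\<^sub>R (R z * c n z)) \<le> indicator S z *\<^sub>R R z"
        by (simp add: indicator_def)
    qed
  qed (use int_Rc in \<open>auto simp: set_integrable_def\<close>)
  ultimately have "(\<lambda>n. (LINT z:S|lborel. w (e n) z) + (LINT z:S|lborel. R z * c n z) / 2)
      \<longlonglongrightarrow> (LINT z:S|lborel. w 0 z) + (LINT z:S|lborel. 0) / 2"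
    by (intro tendsto_intros) auto
  moreover have "cmod (LINT z:S|lborel. H z * p z * q z)
      \<le> (LINT z:S|lborel. w (e n) z) + (LINT z:S|lborel. R z * c n z) / 2" for n
    unfolding w_def R_def c_def by (rule regularized_inequality[OF S(1) K zero \<eta> p q H e(1)])
  ultimately have "cmod (LINT z:S|lborel. H z * p z * q z)
      \<le> (LINT z:S|lborel. w 0 z) + (LINT z:S|lborel. (0::real)) / 2"
    by (intro LIMSEQ_le_const) auto
  then show ?thesis by (simp add: w_def set_lebesgue_integral_def)
qed

section \<open>The inequality for test functions\<close>

theorem lemma1p11:
  fixes \<Omega> :: "complex set" and H \<eta> :: "complex \<Rightarrow> complex"
  assumes "open \<Omega>" "connected \<Omega>" "\<Omega> \<noteq> {}"
    and "H holomorphic_on \<Omega>"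
    and "\<eta> \<in> test_functions \<Omega>"
    and "\<exists>\<xi>\<in>\<Omega>. \<eta> \<xi> \<noteq> 0"
  shows "(LINT \<xi>:\<Omega>|lborel. cmod (H \<xi>) * (cmod (wirtinger_bar \<eta> \<xi>))\<^sup>2)
           \<ge> cmod (LINT \<xi>:\<Omega>|lborel. H \<xi> * wirtinger \<eta> \<xi> * wirtinger_bar \<eta> \<xi>)"
proof -
  have Ck: "Ck_on k \<Omega> \<eta>" for k
    using assms(5) by (simp add: test_functions_def smooth_on_def)
  obtain p1 p2 q1 q2 where pq: "has_wirtinger_on (wirtinger \<eta>) p1 p2 \<Omega>"
      "has_wirtinger_on (wirtinger_bar \<eta>) q1 q2 \<Omega>"
    using Ck_on_wirtinger[OF Ck] by blast
  \<comment> \<open>The closure of the support takes the role of the compact set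
    \<open>K\<close>.\<close>
  have "\<eta> z = 0" if "z \<in> \<Omega> - closure (support_on \<Omega> \<eta>)" for z
    using that closure_subset[of "support_on \<Omega> \<eta>"] by (auto simp: support_on_def)
  with assms(5) show ?thesis
    by (intro weighted_wirtinger_product_le[OF assms(1,2) _ _ _ has_wirtinger_on_Ck_on[OF Ck] pq assms(4),
          of "closure (support_on \<Omega> \<eta>)"]) (auto simp: test_functions_def)
qed

end
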